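(* Let $a<b$ be real numbers, $\alpha\in(0,1)$, and let $p,q,r$ be real-valued continuous functions on $[a,b]$ with $p(t)\neq0$ and $r(t)>0$ for all $t\in[a,b]$. Let $c_1,c_2,d_1,d_2\in\mathbb{R}$ with $c_1^2+c_2^2\neq0$ and $d_1^2+d_2^2\neq0$. Consider the fractional Sturm--Liouville problem $${}^{ABC}_{a}D^\alpha\big(p(t)\,{}^{ABR}D^\alpha_b x(t)\big)+q(t)x(t)=\lambda r(t)x(t),\qquad t\in(a,b),$$ $$c_1\,\mathbf{E}^1_{\alpha,1,\frac{-\alpha}{1-\alpha},b^-}x(a)+c_2\,{}^{ABR}D_b^\alpha x(a)=0,$$ $$d_1\,\mathbf{E}^1_{\alpha,1,\frac{-\alpha}{1-\alpha},b^-}x(b)+d_2\,{}^{ABR}D_b^\alpha x(b)=0.$$ Eigenfunctions corresponding to distinct eigenvalues of this problem are orthogonal with respect to the weight function $r$ on $[a,b]$: if $\lambda_1\neq\lambda_2$ are eigenvalues with corresponding eigenfunctions $x_{\lambda_1},x_{\lambda_2}$, then $$\int_a^b r(t)\,x_{\lambda_1}(t)\,x_{\lambda_2}(t)\,dt=0.$$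
   Context: For $\alpha\in(0,1)$, $E_\alpha(z)=\sum_{k=0}^\infty \frac{z^k}{\Gamma(\alpha k+1)}$ is the Mittag-Leffler function, and $B(\alpha)>0$ is a normalization constant. For a (complex-valued) $f\in H^1(a,b)$, identified with its continuous representative on $[a,b]$, define $$\mathbf{E}^1_{\alpha,1,\frac{-\alpha}{1-\alpha},b^-}f(t)=\int_t^b E_\alpha\Big(\tfrac{-\alpha}{1-\alpha}(s-t)^\alpha\Big)f(s)\,ds,$$ the right ABR (Riemann--Liouville type) fractional derivative $${}^{ABR}D^\alpha_b f(t)=-\frac{B(\alpha)}{1-\alpha}\frac{d}{dt}\int_t^b f(s)E_\alpha\Big(\tfrac{-\alpha}{1-\alpha}(s-t)^\alpha\Big)ds$$ (one-sided derivatives at the endpoints of $[a,b]$), and the left ABC (Caputo type) fractional derivative $${}^{ABC}_{a}D^\alpha f(t)=\frac{B(\alpha)}{1-\alpha}\int_a^t f'(s)E_\alpha\Big(\tfrac{-\alpha}{1-\alpha}(t-s)^\alpha\Big)ds.$$ A solution of the problem is a complex-valued $x\in H^1(a,b)$ with $p\cdot{}^{ABR}D_b^\alpha x\in H^1(a,b)$ satisfying the equation and both boundary conditions. An eigenvalue is a $\lambda\in\mathbb{C}$ for which there is a nontrivial solution (one not identically zero), called an eigenfunction corresponding to $\lambda$. *)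

theory Defs
  imports "HOL-Analysis.Analysis"
begin

definition mittag_leffler :: "real \<Rightarrow> 'a::{real_normed_field,banach} \<Rightarrow> 'a" where
  "mittag_leffler \<alpha> z = (\<Sum>k. z ^ k / of_real (Gamma (\<alpha> * real k + 1)))"

definition ml_kernel :: "real \<Rightarrow> real \<Rightarrow> real" where
  "ml_kernel \<alpha> u = mittag_leffler \<alpha> (- \<alpha> / (1 - \<alpha>) * u powr \<alpha>)"

definition L2_on :: "real \<Rightarrow> real \<Rightarrow> (real \<Rightarrow> complex) \<Rightarrow> bool" where
  "L2_on a b f \<longleftrightarrow> set_borel_measurable lborel {a<..<b} f \<and>
     set_integrable lborel {a<..<b} (\<lambda>s. (cmod (f s))\<^sup>2)"

text \<open>
  Weak derivatives in \<open>L\<^sup>2(a,b)\<close>, tested against real-valued functions from \<open>C\<^sub>c\<^sup>1(a,b)\<close>. Since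
  \<open>(a,b)\<close> is bounded, a closed support contained in \<open>(a,b)\<close> is automatically compact. Test
  functions from \<open>C\<^sub>c\<^sup>\<infinity>(a,b)\<close>, real or complex, give the same notion.
\<close>

definition has_weak_deriv :: "real \<Rightarrow> real \<Rightarrow> (real \<Rightarrow> complex) \<Rightarrow> (real \<Rightarrow> complex) \<Rightarrow> bool" where
  "has_weak_deriv a b f g \<longleftrightarrow> L2_on a b g \<and>
     (\<forall>\<phi> :: real \<Rightarrow> real. \<phi> C1_differentiable_on UNIV \<and> closure {s. \<phi> s \<noteq> 0} \<subseteq> {a<..<b} \<longrightarrow>
        (LBINT s:{a<..<b}. deriv \<phi> s *\<^sub>R f s) = - (LBINT s:{a<..<b}. \<phi> s *\<^sub>R g s))"

text \<open>
  Membership in \<open>H\<^sup>1(a,b)\<close> of a function that is its own continuous representative on \<open>[a,b]\<close>.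
  Values outside \<open>[a,b]\<close> are irrelevant.
\<close>

definition H1_on :: "real \<Rightarrow> real \<Rightarrow> (real \<Rightarrow> complex) \<Rightarrow> bool" where
  "H1_on a b f \<longleftrightarrow> continuous_on {a..b} f \<and> L2_on a b f \<and> (\<exists>g. has_weak_deriv a b f g)"

text \<open>
  A representative of \<open>f'\<close> for \<open>f \<in> H\<^sup>1(a,b)\<close>. It is determined up to a null set only, and is used
  only under integrals over subintervals of \<open>[a,b]\<close>.
\<close>

definition weak_deriv :: "real \<Rightarrow> real \<Rightarrow> (real \<Rightarrow> complex) \<Rightarrow> real \<Rightarrow> complex" where
  "weak_deriv a b f = (SOME g. has_weak_deriv a b f g)"

definition ml_integral_right :: "real \<Rightarrow> real \<Rightarrow> (real \<Rightarrow> complex) \<Rightarrow> real \<Rightarrow> complex" where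
  "ml_integral_right \<alpha> b f t = (LBINT s:{t..b}. ml_kernel \<alpha> (s - t) *\<^sub>R f s)"

text \<open>The derivative within \<open>[a,b]\<close> is one-sided at the endpoints and two-sided in between.\<close>

definition abr_right ::
  "(real \<Rightarrow> real) \<Rightarrow> real \<Rightarrow> real \<Rightarrow> real \<Rightarrow> (real \<Rightarrow> complex) \<Rightarrow> real \<Rightarrow> complex" where
  "abr_right B \<alpha> a b f t = - (B \<alpha> / (1 - \<alpha>)) *\<^sub>R
     vector_derivative (\<lambda>\<tau>. LBINT s:{\<tau>..b}. ml_kernel \<alpha> (s - \<tau>) *\<^sub>R f s) (at t within {a..b})"

definition abc_left ::
  "(real \<Rightarrow> real) \<Rightarrow> real \<Rightarrow> real \<Rightarrow> real \<Rightarrow> (real \<Rightarrow> complex) \<Rightarrow> real \<Rightarrow> complex" where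
  "abc_left B \<alpha> a b f t =
     (B \<alpha> / (1 - \<alpha>)) *\<^sub>R (LBINT s:{a..t}. ml_kernel \<alpha> (t - s) *\<^sub>R weak_deriv a b f s)"

definition fsl_solution ::
  "(real \<Rightarrow> real) \<Rightarrow> real \<Rightarrow> real \<Rightarrow> real \<Rightarrow> (real \<Rightarrow> real) \<Rightarrow> (real \<Rightarrow> real) \<Rightarrow> (real \<Rightarrow> real) \<Rightarrow>
   real \<Rightarrow> real \<Rightarrow> real \<Rightarrow> real \<Rightarrow> complex \<Rightarrow> (real \<Rightarrow> complex) \<Rightarrow> bool" where
  "fsl_solution B \<alpha> a b p q r c\<^sub>1 c\<^sub>2 d\<^sub>1 d\<^sub>2 lam x \<longleftrightarrow>
     H1_on a b x \<and>
     H1_on a b (\<lambda>t. p t *\<^sub>R abr_right B \<alpha> a b x t) \<and>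
     (\<forall>t\<in>{a<..<b}.
        abc_left B \<alpha> a b (\<lambda>t. p t *\<^sub>R abr_right B \<alpha> a b x t) t + q t *\<^sub>R x t = lam * (r t *\<^sub>R x t)) \<and>
     c\<^sub>1 *\<^sub>R ml_integral_right \<alpha> b x a + c\<^sub>2 *\<^sub>R abr_right B \<alpha> a b x a = 0 \<and>
     d\<^sub>1 *\<^sub>R ml_integral_right \<alpha> b x b + d\<^sub>2 *\<^sub>R abr_right B \<alpha> a b x b = 0"

definition fsl_eigenfunction ::
  "(real \<Rightarrow> real) \<Rightarrow> real \<Rightarrow> real \<Rightarrow> real \<Rightarrow> (real \<Rightarrow> real) \<Rightarrow> (real \<Rightarrow> real) \<Rightarrow> (real \<Rightarrow> real) \<Rightarrow>
   real \<Rightarrow> real \<Rightarrow> real \<Rightarrow> real \<Rightarrow> complex \<Rightarrow> (real \<Rightarrow> complex) \<Rightarrow> bool" where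
  "fsl_eigenfunction B \<alpha> a b p q r c\<^sub>1 c\<^sub>2 d\<^sub>1 d\<^sub>2 lam x \<longleftrightarrow>
     fsl_solution B \<alpha> a b p q r c\<^sub>1 c\<^sub>2 d\<^sub>1 d\<^sub>2 lam x \<and> (\<exists>t\<in>{a..b}. x t \<noteq> 0)"

definition fsl_eigenvalue ::
  "(real \<Rightarrow> real) \<Rightarrow> real \<Rightarrow> real \<Rightarrow> real \<Rightarrow> (real \<Rightarrow> real) \<Rightarrow> (real \<Rightarrow> real) \<Rightarrow> (real \<Rightarrow> real) \<Rightarrow>
   real \<Rightarrow> real \<Rightarrow> real \<Rightarrow> real \<Rightarrow> complex \<Rightarrow> bool" where
  "fsl_eigenvalue B \<alpha> a b p q r c\<^sub>1 c\<^sub>2 d\<^sub>1 d\<^sub>2 lam \<longleftrightarrow>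
     (\<exists>x. fsl_eigenfunction B \<alpha> a b p q r c\<^sub>1 c\<^sub>2 d\<^sub>1 d\<^sub>2 lam x)"

end

theory Submission
  imports Defs
begin

text \<open>
  Write \<open>F\<^sub>i\<close> for the right Mittag-Leffler integral of \<open>x\<^sub>i\<close>, \<open>w\<^sub>i = - c F\<^sub>i'\<close> for its ABR derivative and
  \<open>y\<^sub>i = p w\<^sub>i\<close>, where \<open>c = B(\<alpha>) / (1 - \<alpha>)\<close>. Fubini on the triangle turns the integral of \<open>x\<^sub>j\<close> against the
  ABC derivative of \<open>y\<^sub>i\<close> into \<open>c\<close> times the integral of \<open>y\<^sub>i' F\<^sub>j\<close>, and integration by parts gives
  \<open>c (F\<^sub>j y\<^sub>i)\<close> evaluated between \<open>a\<close> and \<open>b\<close>, plus the integral of \<open>p w\<^sub>i w\<^sub>j\<close>. The last term is symmetric, and so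
  are the boundary terms, because the boundary conditions make \<open>(F\<^sub>1, w\<^sub>1)\<close> and \<open>(F\<^sub>2, w\<^sub>2)\<close> linearly
  dependent at each endpoint. Multiplying each equation by the other eigenfunction, integrating and
  subtracting leaves \<open>\<lambda>\<^sub>1 - \<lambda>\<^sub>2\<close> times the weighted integral of \<open>x\<^sub>1 x\<^sub>2\<close> equal to zero.

  The analytic input is that \<open>H\<^sup>1\<close> functions are integrals of their weak derivatives and that \<open>F\<^sub>i\<close> is
  differentiable everywhere, so that \<open>w\<^sub>i\<close> is not a junk value; \<open>F\<^sub>i\<close> is then \<open>C\<^sup>1\<close> because \<open>y\<^sub>i\<close> is
  continuous and \<open>p\<close> has no zero.
\<close>

section \<open>The Mittag-Leffler kernel\<close>

text \<open>Cut Euler's integral off below \<open>R\<close>; on the remaining half-line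
  \<open>t powr x\<close> is at least \<open>R powr x\<close>, and integrating
  \<open>exp (- t)\<close> leaves \<open>exp (- R)\<close>. Since \<open>R\<close> is free, Gamma
  outgrows every geometric sequence.\<close>

lemma Gamma_ge_powr_exp:
  fixes R x :: real
  assumes "R > 0" "x \<ge> 0"
  shows "R powr x * exp (- R) \<le> Gamma (x + 1)"
proof -
  have G: "((\<lambda>t. t powr x / exp t) has_integral Gamma (x + 1)) {0..}"
    using Gamma_integral_real[of "x + 1"] assms by simp
  have "((\<lambda>t. R powr x * exp (- t)) has_integral R powr x * exp (- R)) {R..}"
    using has_integral_mult_right[OF has_integral_exp_minus_to_infinity[of 1 R], of "R powr x"] by simp
  hence "((\<lambda>t. if t \<in> {R..} then R powr x * exp (- t) else 0) has_integral R powr x * exp (- R)) {0..}"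
    using assms by (subst has_integral_restrict) auto
  then show ?thesis using G
  proof (rule has_integral_le)
    fix t :: real assume "t \<in> {0..}"
    show "(if t \<in> {R..} then R powr x * exp (- t) else 0) \<le> t powr x / exp t"
      using assms powr_mono2[of x R t] by (auto simp: exp_minus field_simps)
  qed
qed

lemma summable_mittag_leffler:
  fixes \<alpha> y :: real
  assumes "\<alpha> > 0"
  shows "summable (\<lambda>k. inverse (Gamma (\<alpha> * real k + 1)) * y ^ k)"
proof (rule summable_comparison_test')
  \<comment> \<open>This \<open>R\<close> gives
    \<open>R powr \<alpha> = 2 * \<bar>y\<bar> + 1\<close>, so the Gamma bound exceeds
    \<open>\<bar>y\<bar> ^ k\<close> by a factor of at least \<open>2 ^ k\<close>, up to the
    constant \<open>exp (- R)\<close>. The summand 1 keeps \<open>R\<close> positive when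
    \<open>y = 0\<close>.\<close>
  define R where "R = (2 * \<bar>y\<bar> + 1) powr (1 / \<alpha>)"
  have R: "R > 0" "R powr \<alpha> = 2 * \<bar>y\<bar> + 1"
    using assms by (auto simp: R_def powr_powr)
  show "summable (\<lambda>k. exp R * (1 / 2) ^ k)"
    by (intro summable_mult summable_geometric) auto
  fix k :: nat
  have "R powr (\<alpha> * real k) = (2 * \<bar>y\<bar> + 1) ^ k"
    using R by (simp add: powr_powr[symmetric] powr_realpow)
  hence G: "(2 * \<bar>y\<bar> + 1) ^ k * exp (- R) \<le> Gamma (\<alpha> * real k + 1)"
    using Gamma_ge_powr_exp[OF R(1), of "\<alpha> * real k"] assms by simp
  have pos: "0 < (2 * \<bar>y\<bar> + 1) ^ k * exp (- R)" by (intro mult_pos_pos zero_less_power) auto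
  have "norm (inverse (Gamma (\<alpha> * real k + 1)) * y ^ k) = inverse (Gamma (\<alpha> * real k + 1)) * \<bar>y\<bar> ^ k"
    using less_le_trans[OF pos G] by (simp add: abs_mult power_abs)
  also have "\<dots> \<le> inverse ((2 * \<bar>y\<bar> + 1) ^ k * exp (- R)) * \<bar>y\<bar> ^ k"
    by (rule mult_right_mono[OF le_imp_inverse_le[OF G pos]]) simp
  also have "\<dots> = exp R * (\<bar>y\<bar> / (2 * \<bar>y\<bar> + 1)) ^ k"
    unfolding power_divide by (simp add: exp_minus divide_inverse mult_ac)
  also have "\<dots> \<le> exp R * (1 / 2) ^ k"
    by (intro mult_left_mono power_mono) (auto simp: divide_le_eq)
  finally show "norm (inverse (Gamma (\<alpha> * real k + 1)) * y ^ k) \<le> exp R * (1 / 2) ^ k" .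
qed

text \<open>The power series converges everywhere, hence is continuous; the inner function
  \<open>u powr \<alpha>\<close> stays continuous at 0 because \<alpha> is positive.\<close>

lemma continuous_on_ml_kernel:
  assumes "\<alpha> > 0"
  shows "continuous_on {0..} (ml_kernel \<alpha>)"
proof -
  have "isCont (mittag_leffler \<alpha> :: real \<Rightarrow> real) z" for z
    using isCont_powser_converges_everywhere[OF summable_mittag_leffler[OF assms], of z]
    by (simp add: mittag_leffler_def[abs_def] field_simps)
  then have "continuous_on UNIV (mittag_leffler \<alpha> :: real \<Rightarrow> real)"
    by (simp add: continuous_on_eq_continuous_at)
  then have "continuous_on {0..} (\<lambda>u. mittag_leffler \<alpha> (- \<alpha> / (1 - \<alpha>) * u powr \<alpha>))"
  proof (rule continuous_on_compose2)
    show "continuous_on {0..} (\<lambda>u. - \<alpha> / (1 - \<alpha>) * u powr \<alpha>)"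
      using assms by (intro continuous_on_mult continuous_on_const continuous_on_powr') (auto intro: continuous_on_id)
  qed auto
  then show ?thesis by (simp add: ml_kernel_def[abs_def])
qed

section \<open>Weak derivatives\<close>

lemma set_integrable_Icc_lborel_iff_Ioo:
  fixes f :: "real \<Rightarrow> 'a::{banach, second_countable_topology}"
  shows "set_integrable lborel {a..b} f \<longleftrightarrow> set_integrable lborel {a<..<b} f"
  unfolding set_integrable_def
  by (rule integrable_discrete_difference[where X="{a, b}"])
    (auto split: split_indicator)

lemma set_integral_Icc_eq_Ioo:
  fixes f :: "real \<Rightarrow> 'a::{banach, second_countable_topology}"
  shows "(LBINT s:{a..b}. f s) = (LBINT s:{a<..<b}. f s)"
  by (rule set_integral_discrete_difference[where X="{a, b}"]) auto

text \<open>Domination by \<open>1 + (cmod (g s))\<^sup>2\<close>, which is integrable because the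
  interval is bounded.\<close>

lemma L2_on_imp_set_integrable:
  assumes "L2_on a b g"
  shows "set_integrable lborel {a..b} g"
proof -
  have "set_integrable lborel {a<..<b} (\<lambda>s. 1 :: real)"
    by (cases "a < b") (auto simp: set_integrable_def)
  moreover have "set_integrable lborel {a<..<b} (\<lambda>s. (cmod (g s))\<^sup>2)"
    using assms by (simp add: L2_on_def)
  ultimately have "set_integrable lborel {a<..<b} (\<lambda>s. 1 + (cmod (g s))\<^sup>2)"
    by (rule set_integral_add)
  then have "set_integrable lborel {a<..<b} g"
  proof (rule set_integrable_bound)
    show "set_borel_measurable lborel {a<..<b} g" using assms by (simp add: L2_on_def)
    have "x \<le> 1 + x\<^sup>2" for x :: real
      using zero_le_power2[of "x - 1/2"] by (simp add: power2_eq_square algebra_simps)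
    then show "AE s in lborel. s \<in> {a<..<b} \<longrightarrow> norm (g s) \<le> norm (1 + (cmod (g s))\<^sup>2)"
      by (auto intro!: AE_I2 simp: abs_of_nonneg)
  qed
  then show ?thesis by (simp add: set_integrable_Icc_lborel_iff_Ioo)
qed

text \<open>
  The test functions are differences of rescaled copies of the quadratic spline \<open>smoothstep\<close>,
  which rises from 0 to 1 on \<open>[0,2]\<close>: it is the simplest \<open>C\<^sup>1\<close> step, and its derivative \<open>tent\<close> is
  an approximate identity.
\<close>

definition tent :: "real \<Rightarrow> real" where
  "tent u = max 0 u - 2 * max 0 (u - 1) + max 0 (u - 2)"

definition smoothstep :: "real \<Rightarrow> real" where
  "smoothstep u = ((max 0 u)\<^sup>2 - 2 * (max 0 (u - 1))\<^sup>2 + (max 0 (u - 2))\<^sup>2) / 2"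

lemma DERIV_max0_square: "((\<lambda>u. (max 0 u)\<^sup>2) has_real_derivative 2 * max 0 u) (at u)"
proof -
  consider "u > 0" | "u < 0" | "u = 0" by linarith
  then show ?thesis
  proof cases
    case 1
    have "((\<lambda>u. u\<^sup>2) has_real_derivative 2 * max 0 u) (at u)"
      using 1 by (auto intro!: derivative_eq_intros)
    then show ?thesis
      by (rule has_field_derivative_transform_within[where d = u]) (use 1 in \<open>auto simp: dist_real_def\<close>)
  next
    case 2
    have "((\<lambda>u. 0) has_real_derivative 2 * max 0 u) (at u)"
      using 2 by (auto intro!: derivative_eq_intros)
    then show ?thesis
      by (rule has_field_derivative_transform_within[where d = "-u"]) (use 2 in \<open>auto simp: dist_real_def\<close>)
  next
    case 3
    \<comment> \<open>At the kink the difference quotient \<open>(max 0 h)\<^sup>2 / h\<close> is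
      \<open>max 0 h\<close> itself, which tends to 0.\<close>
    have "(\<lambda>h. max 0 h) \<midarrow>0::real\<rightarrow> max 0 0"
      by (intro tendsto_intros)
    moreover have "\<forall>\<^sub>F h in at 0. max 0 h = (max 0 h)\<^sup>2 / (h::real)"
      by (auto simp: eventually_at_filter power2_eq_square max_def intro!: always_eventually)
    ultimately have "(\<lambda>h. (max 0 h)\<^sup>2 / h) \<midarrow>0::real\<rightarrow> 0"
      using Lim_transform_eventually by fastforce
    then show ?thesis by (simp add: DERIV_def 3)
  qed
qed

lemma DERIV_smoothstep: "(smoothstep has_real_derivative tent u) (at u)"
  unfolding smoothstep_def[abs_def] tent_def
  by (rule derivative_eq_intros DERIV_chain2[OF DERIV_max0_square] refl | simp)+

lemma continuous_tent: "continuous_on S tent"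
  unfolding tent_def[abs_def] by (intro continuous_intros)

lemma tent_zero: "u \<le> 0 \<or> u \<ge> 2 \<Longrightarrow> tent u = 0"
  by (auto simp: tent_def max_def)

lemma smoothstep_eq: "u \<le> 0 \<Longrightarrow> smoothstep u = 0" "u \<ge> 2 \<Longrightarrow> smoothstep u = 1"
  by (auto simp: smoothstep_def max_def power2_eq_square algebra_simps)

lemma tent_bounds: "0 \<le> tent u" "tent u \<le> 1"
  by (auto simp: tent_def max_def)

text \<open>The derivative \<open>tent\<close> is nonnegative, so the spline is monotone and its two
  plateau values bound it.\<close>

lemma smoothstep_bounds: "0 \<le> smoothstep u" "smoothstep u \<le> 1"
proof -
  have mono: "smoothstep x \<le> smoothstep y" if "x \<le> y" for x y
    using that by (rule DERIV_nonneg_imp_nondecreasing) (use DERIV_smoothstep tent_bounds in blast)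
  show "0 \<le> smoothstep u" using mono[of "min u 0" u] by (simp add: smoothstep_eq)
  show "smoothstep u \<le> 1" using mono[of u "max u 2"] by (simp add: smoothstep_eq)
qed

lemma integral_tent: "(LBINT u. tent u) = 1" 
proof -
  have "(LBINT u. indicator {0..2} u *\<^sub>R tent u) = smoothstep 2 - smoothstep 0"
    by (rule integral_FTC_atLeastAtMost)
      (auto intro: continuous_tent has_field_derivative_at_within[OF DERIV_smoothstep] simp flip: has_real_derivative_iff_has_vector_derivative)
  moreover have "(\<lambda>u. indicator {0..2} u *\<^sub>R tent u) = tent"
    by (auto simp: fun_eq_iff tent_zero split: split_indicator)
  ultimately show ?thesis by (simp add: smoothstep_eq)
qed

text \<open>Substituting \<open>u = N * (s - c) + d\<close> with \<open>N = Suc n\<close> fixes the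
  bump and lets the argument of \<open>f\<close> tend to \<open>c\<close>; dominated convergence on
  [0,2] finishes. The shift \<open>d\<close> decides on which side of \<open>c\<close> the bump
  sits: it occupies \<open>c - d / N\<close> to \<open>c + (2 - d) / N\<close>.\<close>

lemma tent_approximate_identity:
  fixes f :: "real \<Rightarrow> complex"
  assumes f: "continuous_on UNIV f" and M: "\<And>s. norm (f s) \<le> M"
  shows "(\<lambda>n. LBINT s. (real (Suc n) * tent (real (Suc n) * (s - c) + d)) *\<^sub>R f s) \<longlonglongrightarrow> f c"
proof -
  have [measurable]: "f \<in> borel_measurable borel" "tent \<in> borel_measurable borel"
    using f continuous_tent by (auto intro: borel_measurable_continuous_onI)
  have eq: "(LBINT s. (real (Suc n) * tent (real (Suc n) * (s - c) + d)) *\<^sub>R f s) =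
     (LBINT u. tent u *\<^sub>R f (c + (u - d) / real (Suc n)))" for n
    by (subst lborel_integral_real_affine[where c = "1 / real (Suc n)" and t = "c - d / real (Suc n)"])
      (auto simp: field_simps simp del: of_nat_Suc integral_scaleR_right
       simp flip: integral_scaleR_right intro!: Bochner_Integration.integral_cong arg_cong[where f = f] arg_cong[where f = tent] arg_cong2[where f = scaleR])
  have "(\<lambda>n. LBINT u. tent u *\<^sub>R f (c + (u - d) / real (Suc n))) \<longlonglongrightarrow> (LBINT u. tent u *\<^sub>R f c)"
  proof (rule integral_dominated_convergence[where w = "\<lambda>u. indicator {0..2} u *\<^sub>R M"])
    show "integrable lborel (\<lambda>u. indicator {0..2::real} u *\<^sub>R M)" by simp
    have "(\<lambda>n. c + (u - d) / real (Suc n)) \<longlonglongrightarrow> c" for u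
      using tendsto_add[OF tendsto_const LIMSEQ_Suc[OF lim_const_over_n[of "u - d"]], of c] by simp
    then have "(\<lambda>n. f (c + (u - d) / real (Suc n))) \<longlonglongrightarrow> f c" for u
      using f by (auto simp: continuous_on_eq_continuous_at intro: isCont_tendsto_compose)
    then show "AE u in lborel. (\<lambda>n. tent u *\<^sub>R f (c + (u - d) / real (Suc n))) \<longlonglongrightarrow> tent u *\<^sub>R f c"
      by (intro AE_I2 tendsto_intros)
    have M0: "M \<ge> 0" using M[of 0] norm_ge_zero order_trans by blast
    have "norm (tent u *\<^sub>R f z) \<le> indicator {0..2} u *\<^sub>R M" for u z
      using tent_bounds[of u] M[of z] M0 mult_mono[of "tent u" 1 "norm (f z)" M]
      by (auto simp: tent_zero split: split_indicator)
    then show "AE u in lborel. norm (tent u *\<^sub>R f (c + (u - d) / real (Suc n))) \<le> indicator {0..2} u *\<^sub>R M" for n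
      by simp
  qed measurable
  moreover have "(LBINT u. tent u *\<^sub>R f c) = f c"
  proof -
    \<comment> \<open>A non-integrable function has integral 0 by convention, so the value 1 already
      forces integrability.\<close>
    have "integrable lborel tent"
      by (rule ccontr) (use integral_tent not_integrable_integral_eq[of lborel tent] in simp)
    then show ?thesis by (simp add: integral_tent)
  qed
  ultimately show ?thesis unfolding eq by simp
qed


lemma integrable_tent_scaleR:
  fixes f :: "real \<Rightarrow> complex"
  assumes f: "continuous_on UNIV f" and N: "N > 0"
  shows "integrable lborel (\<lambda>s. (N * tent (N * (s - c) + d)) *\<^sub>R f s)"
proof -
  let ?A = "{c - d / N .. c + (2 - d) / N}"
  have "integrable lborel (\<lambda>s. indicator ?A s *\<^sub>R ((N * tent (N * (s - c) + d)) *\<^sub>R f s))"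
    using f by (intro borel_integrable_compact continuous_intros continuous_on_compose2[OF continuous_tent[of UNIV]])
      (auto intro: continuous_on_subset)
  moreover have "tent (N * (s - c) + d) = 0" if "s \<notin> ?A" for s
    using that N by (intro tent_zero) (auto simp: field_simps)
  then have "(\<lambda>s. indicator ?A s *\<^sub>R ((N * tent (N * (s - c) + d)) *\<^sub>R f s)) =
      (\<lambda>s. (N * tent (N * (s - c) + d)) *\<^sub>R f s)"
    by (auto simp: fun_eq_iff indicator_def)
  ultimately show ?thesis by metis
qed

text \<open>Test with \<phi> close to the indicator of [t,b]. Its derivative is a bump near
  \<open>t\<close> minus a bump near \<open>b\<close>, so one side of the weak identity tends to
  \<open>f t - f b\<close>, while the other tends to minus the integral of \<open>g\<close> over
  [t,b].\<close>

lemma has_weak_deriv_imp_FTC: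
  assumes f: "continuous_on {a..b} f" and g: "has_weak_deriv a b f g" and t: "t \<in> {a..b}"
  shows "f t = f b - (LBINT s:{t..b}. g s)"
proof (cases "t = b")
  case True
  have "(LBINT s:{b..b}. g s) = (LBINT s:{b<..<b}. g s)" by (rule set_integral_Icc_eq_Ioo)
  then show ?thesis using True by (simp add: set_lebesgue_integral_def)
next
  case False
  with t have tb: "a \<le> t" "t < b" by auto
  \<comment> \<open>Clamping the argument extends \<open>f\<close> to a bounded continuous function
    on the whole line, as the approximate identity requires.\<close>
  define F where "F s = f (max a (min b s))" for s
  have F: "continuous_on UNIV F"
    unfolding F_def using tb by (intro continuous_on_compose2[OF f] continuous_intros) auto
  obtain M where "\<And>x. x \<in> {a..b} \<Longrightarrow> norm (f x) \<le> M"
    using compact_imp_bounded[OF compact_continuous_image[OF f compact_Icc]]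
    by (force simp: bounded_iff)
  then have M: "norm (F s) \<le> M" for s using tb by (auto simp: F_def)
  have gint: "set_integrable lborel {a<..<b} g"
    using g L2_on_imp_set_integrable[of a b g]
    by (simp add: has_weak_deriv_def set_integrable_Icc_lborel_iff_Ioo)
  define N where "N n = real (Suc n)" for n
  have N: "N n > 0" for n by (simp add: N_def)
  \<comment> \<open>The shifts -1 and 3 make \<phi> rise between \<open>t + 1 / N n\<close> and
    \<open>t + 3 / N n\<close> and fall between \<open>b - 3 / N n\<close> and
    \<open>b - 1 / N n\<close>. The support thus stays inside the open interval even for
    \<open>t = a\<close>.\<close>
  define \<phi> where "\<phi> n s = smoothstep (N n * (s - t) + (-1)) - smoothstep (N n * (s - b) + 3)" for n s
  define \<psi> where "\<psi> n s = N n * tent (N n * (s - t) + (-1)) - N n * tent (N n * (s - b) + 3)" for n s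
  have der: "(\<phi> n has_real_derivative \<psi> n s) (at s)" for n s
    unfolding \<phi>_def \<psi>_def
    by (rule derivative_eq_intros DERIV_chain2[OF DERIV_smoothstep] refl | simp)+
  have C1: "\<phi> n C1_differentiable_on UNIV" for n
    unfolding C1_differentiable_on_def
  proof (intro exI conjI ballI)
    show "(\<phi> n has_vector_derivative \<psi> n s) (at s)" for s
      using der by (simp add: has_real_derivative_iff_has_vector_derivative)
    show "continuous_on UNIV (\<psi> n)"
      unfolding \<psi>_def[abs_def] by (intro continuous_intros continuous_on_compose2[OF continuous_tent[of UNIV]]) auto
  qed
  have "\<forall>\<^sub>F n in sequentially. N n > 6 / (b - t)"
    unfolding N_def by (rule filterlim_at_top_dense[THEN iffD1, rule_format, OF filterlim_compose[OF filterlim_real_sequentially filterlim_Suc]])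
  \<comment> \<open>Each ramp ends within \<open>3 / N n\<close> of its endpoint, so the threshold 6
    keeps the two ramps disjoint.\<close>
  then have ev: "\<forall>\<^sub>F n in sequentially. N n * (b - t) > 6"
    using tb by (auto elim!: eventually_mono simp: field_simps)
  have lhs: "(LBINT s:{a<..<b}. deriv (\<phi> n) s *\<^sub>R f s) =
      (LBINT s. (N n * tent (N n * (s - t) + (-1))) *\<^sub>R F s) - (LBINT s. (N n * tent (N n * (s - b) + 3)) *\<^sub>R F s)"
    and rhs: "(LBINT s:{a<..<b}. \<phi> n s *\<^sub>R g s) = (LBINT s. \<phi> n s *\<^sub>R (indicator {a<..<b} s *\<^sub>R g s))"
    and supp: "closure {s. \<phi> n s \<noteq> 0} \<subseteq> {a<..<b}"
    if n: "N n * (b - t) > 6" for n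
  proof -
    \<comment> \<open>To the left of this interval both steps are 0, to the right both are 1 and
      cancel; both tents vanish on either side.\<close>
    have *: "s \<in> {t + 1 / N n .. b - 1 / N n}" if "\<phi> n s \<noteq> 0 \<or> \<psi> n s \<noteq> 0" for s
    proof (rule ccontr)
      assume "s \<notin> {t + 1 / N n .. b - 1 / N n}"
      then consider "N n * (s - t) + (-1) < 0" | "N n * (s - b) + 3 > 2"
        using N[of n] by (force simp: field_simps)
      then show False
      proof cases
        case 1
        then have "N n * (s - b) + 3 \<le> 0" using n by (simp add: algebra_simps)
        with 1 that show False by (auto simp: \<phi>_def \<psi>_def smoothstep_eq tent_zero)
      next
        case 2
        then have "N n * (s - t) + (-1) \<ge> 2" using n by (simp add: algebra_simps)
        with 2 that show False by (auto simp: \<phi>_def \<psi>_def smoothstep_eq tent_zero)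
      qed
    qed
    have "closure {s. \<phi> n s \<noteq> 0} \<subseteq> {t + 1 / N n .. b - 1 / N n}"
      using * by (intro closure_minimal) auto
    also have sub: "{t + 1 / N n .. b - 1 / N n} \<subseteq> {a<..<b}"
    proof -
      have "1 / N n > 0" using N[of n] by simp
      then have "a < s" "s < b" if "t + 1 / N n \<le> s" "s \<le> b - 1 / N n" for s
        using tb that by linarith+
      then show ?thesis by auto
    qed
    finally show "closure {s. \<phi> n s \<noteq> 0} \<subseteq> {a<..<b}" .
    have "(LBINT s:{a<..<b}. deriv (\<phi> n) s *\<^sub>R f s) = (LBINT s. \<psi> n s *\<^sub>R F s)"
      unfolding set_lebesgue_integral_def DERIV_imp_deriv[OF der]
      using * sub by (intro Bochner_Integration.integral_cong refl) (force simp: F_def indicator_def)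
    also have "\<dots> = (LBINT s. (N n * tent (N n * (s - t) + (-1))) *\<^sub>R F s) - (LBINT s. (N n * tent (N n * (s - b) + 3)) *\<^sub>R F s)"
      unfolding \<psi>_def scaleR_diff_left
      by (intro Bochner_Integration.integral_diff integrable_tent_scaleR F N)
    finally show "(LBINT s:{a<..<b}. deriv (\<phi> n) s *\<^sub>R f s) = \<dots>" .
    show "(LBINT s:{a<..<b}. \<phi> n s *\<^sub>R g s) = (LBINT s. \<phi> n s *\<^sub>R (indicator {a<..<b} s *\<^sub>R g s))"
      unfolding set_lebesgue_integral_def by (simp add: mult.commute)
  qed
  have limF: "(\<lambda>n. (LBINT s. (N n * tent (N n * (s - t) + (-1))) *\<^sub>R F s) - (LBINT s. (N n * tent (N n * (s - b) + 3)) *\<^sub>R F s))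
      \<longlonglongrightarrow> F t - F b"
    unfolding N_def by (intro tendsto_diff tent_approximate_identity[OF F M])
  have "(\<lambda>n. LBINT s. \<phi> n s *\<^sub>R (indicator {a<..<b} s *\<^sub>R g s)) \<longlonglongrightarrow>
      (LBINT s. indicator {t..b} s *\<^sub>R (indicator {a<..<b} s *\<^sub>R g s))"
  proof (rule integral_dominated_convergence[where w = "\<lambda>s. norm (indicator {a<..<b} s *\<^sub>R g s)"])
    have [measurable]: "(\<lambda>s. indicator {a<..<b} s *\<^sub>R g s) \<in> borel_measurable borel"
      using gint by (auto simp: set_integrable_def)
    have [measurable]: "\<phi> n \<in> borel_measurable borel" for n
      using der by (intro borel_measurable_continuous_onI) (auto simp: continuous_on_eq_continuous_at intro: DERIV_isCont)
    show "(\<lambda>s. indicator {t..b} s *\<^sub>R (indicator {a<..<b} s *\<^sub>R g s)) \<in> borel_measurable lborel" by measurable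
    show "(\<lambda>s. \<phi> n s *\<^sub>R (indicator {a<..<b} s *\<^sub>R g s)) \<in> borel_measurable lborel" for n by measurable
    show "integrable lborel (\<lambda>s. norm (indicator {a<..<b} s *\<^sub>R g s))"
      using gint unfolding set_integrable_def by (rule integrable_norm)
    have "\<bar>\<phi> n s\<bar> \<le> 1" for n s
      using smoothstep_bounds[of "N n * (s - t) + (-1)"] smoothstep_bounds[of "N n * (s - b) + 3"]
      by (simp add: \<phi>_def)
    then show "AE s in lborel. norm (\<phi> n s *\<^sub>R (indicator {a<..<b} s *\<^sub>R g s)) \<le> norm (indicator {a<..<b} s *\<^sub>R g s)" for n
      by (intro AE_I2, subst norm_scaleR, intro mult_left_le_one_le) auto
    \<comment> \<open>The point \<open>t\<close> is excluded because \<phi> eventually vanishes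
      there while the indicator is 1; a single point is null. For \<open>s \<ge> b\<close> the
      factor \<open>indicator {a<..<b} s\<close> is 0.\<close>
    have lim: "\<forall>\<^sub>F n in sequentially. \<phi> n s = indicator {t..b} s" if "s \<noteq> t" "s < b" for s
    proof -
      have ev': "\<forall>\<^sub>F n in sequentially. N n > c" for c
        unfolding N_def by (rule filterlim_at_top_dense[THEN iffD1, rule_format, OF filterlim_compose[OF filterlim_real_sequentially filterlim_Suc]])
      show ?thesis
        using ev'[of "3 / (b - s)"] ev'[of "3 / \<bar>s - t\<bar>"]
      proof eventually_elim
        case (elim n)
        have "N n * (s - b) + 3 \<le> 0" using elim(1) that by (simp add: field_simps)
        moreover have "N n * (s - t) + (-1) \<le> 0" if "s < t"
          using that N[of n] mult_nonneg_nonpos[of "N n" "s - t"] by simp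
        moreover have "N n * (s - t) + (-1) \<ge> 2" if "s > t"
          using that elim(2) by (simp add: field_simps)
        ultimately show ?case using that by (cases "s < t") (auto simp: \<phi>_def smoothstep_eq)
      qed
    qed
    show "AE s in lborel. (\<lambda>n. \<phi> n s *\<^sub>R (indicator {a<..<b} s *\<^sub>R g s)) \<longlonglongrightarrow> indicator {t..b} s *\<^sub>R (indicator {a<..<b} s *\<^sub>R g s)"
      using AE_lborel_singleton[of t]
    proof eventually_elim
      case (elim s)
      show ?case
      proof (cases "s < b")
        case True
        with elim show ?thesis by (intro tendsto_scaleR tendsto_const tendsto_eventually lim)
      qed simp
    qed
  qed
  then have "(\<lambda>n. - (LBINT s. \<phi> n s *\<^sub>R (indicator {a<..<b} s *\<^sub>R g s))) \<longlonglongrightarrow>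
      - (LBINT s. indicator {t..b} s *\<^sub>R (indicator {a<..<b} s *\<^sub>R g s))"
    by (rule tendsto_minus)
  then have "(\<lambda>n. (LBINT s. (N n * tent (N n * (s - t) + (-1))) *\<^sub>R F s) - (LBINT s. (N n * tent (N n * (s - b) + 3)) *\<^sub>R F s))
      \<longlonglongrightarrow> - (LBINT s. indicator {t..b} s *\<^sub>R (indicator {a<..<b} s *\<^sub>R g s))"
  proof (rule Lim_transform_eventually)
    show "\<forall>\<^sub>F n in sequentially. - (LBINT s. \<phi> n s *\<^sub>R (indicator {a<..<b} s *\<^sub>R g s)) =
     (LBINT s. (N n * tent (N n * (s - t) + (-1))) *\<^sub>R F s) - (LBINT s. (N n * tent (N n * (s - b) + 3)) *\<^sub>R F s)"
      using ev
    proof eventually_elim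
      case (elim n)
      have "(LBINT s:{a<..<b}. deriv (\<phi> n) s *\<^sub>R f s) = - (LBINT s:{a<..<b}. \<phi> n s *\<^sub>R g s)"
        using g C1 supp[OF elim] by (simp add: has_weak_deriv_def)
      then show ?case by (simp only: lhs[OF elim] rhs[OF elim])
    qed
  qed
  with limF have "F t - F b = - (LBINT s. indicator {t..b} s *\<^sub>R (indicator {a<..<b} s *\<^sub>R g s))"
    by (rule LIMSEQ_unique)
  also have "(LBINT s. indicator {t..b} s *\<^sub>R (indicator {a<..<b} s *\<^sub>R g s)) = (LBINT s:{t..b}. g s)"
    unfolding set_lebesgue_integral_def
    by (rule integral_discrete_difference[where X = "{a, b}"]) (use tb in \<open>auto simp: indicator_def\<close>)
  finally show ?thesis using tb by (simp add: F_def algebra_simps)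
qed

section \<open>Fubini on a triangle and integration by parts\<close>

lemma set_integrable_mult_continuous:
  fixes f g :: "real \<Rightarrow> complex"
  assumes g: "set_integrable lborel {a..b} g" and f: "continuous_on {a..b} f"
  shows "set_integrable lborel {a..b} (\<lambda>s. f s * g s)"
proof -
  obtain M where M: "\<And>x. x \<in> {a..b} \<Longrightarrow> norm (f x) \<le> M"
    using compact_imp_bounded[OF compact_continuous_image[OF f compact_Icc]]
    by (force simp: bounded_iff)
  have [measurable]: "(\<lambda>x. indicator {a..b} x *\<^sub>R f x) \<in> borel_measurable borel"
    "(\<lambda>x. indicator {a..b} x *\<^sub>R g x) \<in> borel_measurable borel"
    using borel_measurable_continuous_on_indicator[OF _ f] g
    by (auto simp: set_integrable_def)
  have eq: "(\<lambda>x. indicator {a..b} x *\<^sub>R (f x * g x)) =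
      (\<lambda>x. (indicator {a..b} x *\<^sub>R f x) * (indicator {a..b} x *\<^sub>R g x))"
    by (auto simp: fun_eq_iff split: split_indicator)
  have "integrable lborel (\<lambda>x. M *\<^sub>R (indicator {a..b} x *\<^sub>R g x))"
    using g unfolding set_integrable_def by (intro integrable_scaleR_right)
  then show ?thesis
    unfolding set_integrable_def
  proof (rule Bochner_Integration.integrable_bound)
    show "(\<lambda>x. indicator {a..b} x *\<^sub>R (f x * g x)) \<in> borel_measurable lborel"
      unfolding eq by measurable
    have "norm (f x) \<le> \<bar>M\<bar>" if "x \<in> {a..b}" for x using M[OF that] by linarith
    then show "AE x in lborel. norm (indicator {a..b} x *\<^sub>R (f x * g x)) \<le> norm (M *\<^sub>R (indicator {a..b} x *\<^sub>R g x))"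
      by (intro AE_I2) (auto simp: norm_mult split: split_indicator intro!: mult_right_mono)
  qed
qed

text \<open>Both sides integrate \<open>k (t - s) * u t * v s\<close> over the triangle
  \<open>a \<le> s \<le> t \<le> b\<close>, in the two orders. The kernel is bounded there, so a
  multiple of the integrable product \<open>u t * v s\<close> dominates. This makes the left and
  right kernel operators adjoint.\<close>

lemma Fubini_triangle:
  fixes k :: "real \<Rightarrow> real" and u v :: "real \<Rightarrow> complex"
  assumes k: "continuous_on {0..b - a} k" and ab: "a \<le> b"
    and u: "set_integrable lborel {a..b} u" and v: "set_integrable lborel {a..b} v"
  shows "(LBINT t:{a..b}. u t * (LBINT s:{a..t}. k (t - s) *\<^sub>R v s)) =
    (LBINT s:{a..b}. v s * (LBINT t:{s..b}. k (t - s) *\<^sub>R u t))"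
proof -
  \<comment> \<open>Clamping makes the kernel continuous and bounded on the whole line; on the
    triangle \<open>t - s\<close> lies in [0,b-a], where \<open>K\<close> and \<open>k\<close>
    agree.\<close>
  define K where "K x = k (max 0 (min (b - a) x))" for x
  have K: "continuous_on UNIV K"
    unfolding K_def using ab by (intro continuous_on_compose2[OF k] continuous_intros) auto
  obtain M where "\<And>x. x \<in> {0..b-a} \<Longrightarrow> norm (k x) \<le> M"
    using compact_imp_bounded[OF compact_continuous_image[OF k compact_Icc]]
    by (force simp: bounded_iff)
  then have M: "norm (K s) \<le> M" for s using ab by (auto simp: K_def)
  define U where "U t = indicator {a..b} t *\<^sub>R u t" for t
  define V where "V t = indicator {a..b} t *\<^sub>R v t" for t
  have U: "integrable lborel U" and V: "integrable lborel V"
    using u v by (simp_all add: U_def[abs_def] V_def[abs_def] set_integrable_def)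
  have [measurable]: "U \<in> borel_measurable borel" "V \<in> borel_measurable borel" "K \<in> borel_measurable borel"
    using U V K by (auto intro: borel_measurable_continuous_onI)
  define \<Phi> where "\<Phi> t s = (if s \<le> t then K (t - s) else 0) *\<^sub>R (U t * V s)" for t s
  have [measurable]: "case_prod \<Phi> \<in> borel_measurable (lborel \<Otimes>\<^sub>M lborel)"
    unfolding \<Phi>_def by measurable
  have "integrable (lborel \<Otimes>\<^sub>M lborel) (\<lambda>(t, s). U t * V s)"
  proof (rule lborel_pair.Fubini_integrable)
    show "(\<lambda>(t, s). U t * V s) \<in> borel_measurable (lborel \<Otimes>\<^sub>M lborel)" by measurable
    show "integrable lborel (\<lambda>t. LBINT s. norm (case (t, s) of (t, s) \<Rightarrow> U t * V s))"
      using U V by (simp add: norm_mult)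
    show "AE t in lborel. integrable lborel (\<lambda>s. case (t, s) of (t, s) \<Rightarrow> U t * V s)"
      using V by simp
  qed
  then have "integrable (lborel \<Otimes>\<^sub>M lborel) (\<lambda>p. M *\<^sub>R (case p of (t, s) \<Rightarrow> U t * V s))"
    by (rule integrable_scaleR_right)
  then have int: "integrable (lborel \<Otimes>\<^sub>M lborel) (case_prod \<Phi>)"
  proof (rule Bochner_Integration.integrable_bound)
    show "AE p in lborel \<Otimes>\<^sub>M lborel. norm (case_prod \<Phi> p) \<le> norm (M *\<^sub>R (case p of (t, s) \<Rightarrow> U t * V s))"
      using M order_trans[OF M abs_ge_self]
      by (intro AE_I2) (auto simp: \<Phi>_def intro!: mult_right_mono)
  qed measurable
  have "(LBINT t:{a..b}. u t * (LBINT s:{a..t}. k (t - s) *\<^sub>R v s)) = (LBINT t. LBINT s. \<Phi> t s)"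
    unfolding set_lebesgue_integral_def
    by (intro Bochner_Integration.integral_cong refl, subst integral_mult_right_zero[symmetric],
        subst integral_scaleR_right[symmetric], intro Bochner_Integration.integral_cong refl)
      (auto simp: \<Phi>_def U_def V_def K_def split: split_indicator)
  also have "\<dots> = (LBINT s. LBINT t. \<Phi> t s)"
    using lborel_pair.Fubini_integral[OF int] by simp
  also have "\<dots> = (LBINT s:{a..b}. v s * (LBINT t:{s..b}. k (t - s) *\<^sub>R u t))"
    unfolding set_lebesgue_integral_def
    by (intro Bochner_Integration.integral_cong refl, rule sym, subst integral_mult_right_zero[symmetric],
        subst integral_scaleR_right[symmetric], intro Bochner_Integration.integral_cong refl)
      (auto simp: \<Phi>_def U_def V_def K_def split: split_indicator)
  finally show ?thesis .
qed

text \<open>Here \<open>f\<close> is known only as an integral of \<open>g\<close>, with no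
  pointwise derivative. Writing \<open>H t - H a\<close> as the integral of \<open>h\<close> reduces
  the rule to \<open>Fubini_triangle\<close> with constant kernel 1.\<close>

lemma set_integral_by_parts:
  fixes f g H h :: "real \<Rightarrow> complex"
  assumes ab: "a \<le> b" and g: "set_integrable lborel {a..b} g" and f: "continuous_on {a..b} f"
    and fg: "\<And>t. t \<in> {a..b} \<Longrightarrow> f t = f b - (LBINT s:{t..b}. g s)"
    and H: "\<And>t. t \<in> {a..b} \<Longrightarrow> (H has_vector_derivative h t) (at t within {a..b})"
    and h: "continuous_on {a..b} h"
  shows "(LBINT s:{a..b}. H s * g s) = H b * f b - H a * f a - (LBINT s:{a..b}. h s * f s)"
proof -
  have contH: "continuous_on {a..b} H"
    using H has_vector_derivative_continuous by (force simp: continuous_on_eq_continuous_within)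
  have h': "set_integrable lborel {a..b} h"
    by (intro borel_integrable_atLeastAtMost' h)
  have FTC: "(LBINT s:{a..t}. h s) = H t - H a" if "t \<in> {a..b}" for t
    unfolding set_lebesgue_integral_def
    using that by (intro integral_FTC_atLeastAtMost continuous_on_subset[OF h] has_vector_derivative_within_subset[OF H]) auto
  have Hg: "set_integrable lborel {a..b} (\<lambda>s. H s * g s)"
    by (intro set_integrable_mult_continuous g contH)
  have hf: "set_integrable lborel {a..b} (\<lambda>s. h s * f s)"
    by (intro borel_integrable_atLeastAtMost' continuous_intros h f)
  have "(LBINT s:{a..b}. H s * g s) - H a * (f b - f a) = (LBINT s:{a..b}. H s * g s) - H a * (LBINT s:{a..b}. g s)"
    using fg[of a] ab by simp
  also have "\<dots> = (LBINT t:{a..b}. H t * g t - H a * g t)"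
    using Hg g by (subst set_integral_diff) auto
  also have "\<dots> = (LBINT t:{a..b}. g t * (LBINT s:{a..t}. 1 *\<^sub>R h s))"
    by (rule set_lebesgue_integral_cong) (auto simp: FTC algebra_simps)
  also have "\<dots> = (LBINT s:{a..b}. h s * (LBINT t:{s..b}. 1 *\<^sub>R g t))"
    by (rule Fubini_triangle) (auto intro: ab g h')
  also have "\<dots> = (LBINT s:{a..b}. h s * f b - h s * f s)"
  proof (intro set_lebesgue_integral_cong allI impI)
    fix s assume s: "s \<in> {a..b}"
    have "(LBINT t:{s..b}. g t) = f b - f s" unfolding fg[OF s] by simp
    then show "h s * (LBINT t:{s..b}. 1 *\<^sub>R g t) = h s * f b - h s * f s"
      by (simp add: right_diff_distrib)
  qed simp
  also have "\<dots> = (LBINT s:{a..b}. h s) * f b - (LBINT s:{a..b}. h s * f s)"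
    using hf h' by (subst set_integral_diff) auto
  finally show ?thesis using FTC[of b] ab by (simp add: algebra_simps)
qed

section \<open>Differentiability of kernel integrals\<close>

text \<open>Differentiation under the integral sign: the Lipschitz bound dominates the difference
  quotients by \<open>M * norm (G s)\<close>, so the derivative of the kernel has to exist only for
  almost every \<open>s\<close>. This leaves room for a kink at \<open>s = t\<close>.\<close>

lemma has_vector_derivative_integral_lipschitz:
  fixes G :: "real \<Rightarrow> complex" and \<kappa> :: "real \<Rightarrow> real \<Rightarrow> real"
  assumes G: "integrable lborel G" and t: "t \<in> S"
    and int: "\<And>\<tau>. \<tau> \<in> S \<Longrightarrow> integrable lborel (\<lambda>s. \<kappa> s \<tau> *\<^sub>R G s)"
    and lip: "\<And>s \<tau>. \<tau> \<in> S \<Longrightarrow> G s \<noteq> 0 \<Longrightarrow> \<bar>\<kappa> s \<tau> - \<kappa> s t\<bar> \<le> M * \<bar>\<tau> - t\<bar>"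
    and der: "AE s in lborel. G s \<noteq> 0 \<longrightarrow> ((\<kappa> s) has_real_derivative D s) (at t within S)"
    and D: "D \<in> borel_measurable borel"
  shows "((\<lambda>\<tau>. LBINT s. \<kappa> s \<tau> *\<^sub>R G s) has_vector_derivative (LBINT s. D s *\<^sub>R G s)) (at t within S)"
proof -
  define J where "J \<tau> = (LBINT s. \<kappa> s \<tau> *\<^sub>R G s)" for \<tau>
  define L where "L = (LBINT s. D s *\<^sub>R G s)"
  define Q where "Q \<tau> = (1 / (\<tau> - t)) *\<^sub>R (J \<tau> - J t)" for \<tau>
  have [measurable]: "G \<in> borel_measurable borel" "D \<in> borel_measurable borel" using G D by auto
  have "(Q \<longlongrightarrow> L) (at t within S)"
    \<comment> \<open>Dominated convergence applies to sequences, so the limit within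
      \<open>S\<close> is tested along them.\<close>
    unfolding tendsto_at_iff_sequentially comp_def
  proof (intro allI impI)
    fix X :: "nat \<Rightarrow> real" assume X: "\<forall>i. X i \<in> S - {t}" "X \<longlonglongrightarrow> t"
    define q where "q i s = ((\<kappa> s (X i) - \<kappa> s t) / (X i - t)) *\<^sub>R G s" for i s
    have q: "q i s = (1 / (X i - t)) *\<^sub>R (\<kappa> s (X i) *\<^sub>R G s - \<kappa> s t *\<^sub>R G s)" for i s
      by (simp add: q_def scaleR_diff_left[symmetric])
    have qint: "integrable lborel (\<lambda>s. q i s)" for i
      unfolding q using X t by (intro integrable_scaleR_right Bochner_Integration.integrable_diff int) auto
    have "Q (X i) = (LBINT s. q i s)" for i
      unfolding q Q_def J_def using X t
      by (subst Bochner_Integration.integral_diff[symmetric]) (auto intro: int)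
    moreover have "(\<lambda>i. LBINT s. q i s) \<longlonglongrightarrow> L"
      unfolding L_def
    proof (rule integral_dominated_convergence[where w = "\<lambda>s. M *\<^sub>R norm (G s)"])
      show "(\<lambda>s. D s *\<^sub>R G s) \<in> borel_measurable lborel" by measurable
      show "(\<lambda>s. q i s) \<in> borel_measurable lborel" for i using qint by auto
      show "integrable lborel (\<lambda>s. M *\<^sub>R norm (G s))"
        by (intro integrable_scaleR_right integrable_norm G)
      show "AE s in lborel. norm (q i s) \<le> M *\<^sub>R norm (G s)" for i
      proof (rule AE_I2)
        fix s
        show "norm (q i s) \<le> M *\<^sub>R norm (G s)"
        proof (cases "G s = 0")
          case False
          with lip[of "X i" s] X have "\<bar>(\<kappa> s (X i) - \<kappa> s t) / (X i - t)\<bar> \<le> M"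
            by (auto simp: abs_divide divide_le_eq)
          then show ?thesis by (simp only: q_def norm_scaleR real_scaleR_def mult_right_mono norm_ge_zero)
        qed (simp add: q_def)
      qed
      show "AE s in lborel. (\<lambda>i. q i s) \<longlonglongrightarrow> D s *\<^sub>R G s"
        using der
      proof eventually_elim
        case (elim s)
        show ?case
        proof (cases "G s = 0")
          case False
          with elim have "((\<lambda>\<tau>. (\<kappa> s \<tau> - \<kappa> s t) / (\<tau> - t)) \<longlongrightarrow> D s) (at t within S)"
            by (simp add: has_field_derivative_iff)
          then have "(\<lambda>i. (\<kappa> s (X i) - \<kappa> s t) / (X i - t)) \<longlonglongrightarrow> D s"
            using X unfolding tendsto_at_iff_sequentially comp_def by blast
          then show ?thesis unfolding q_def by (intro tendsto_intros)
        qed (simp add: q_def)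
      qed
    qed
    ultimately show "(\<lambda>i. Q (X i)) \<longlonglongrightarrow> L" by simp
  qed
  then have "((\<lambda>\<tau>. norm (Q \<tau> - L)) \<longlongrightarrow> 0) (at t within S)"
    by (simp add: LIM_zero_iff tendsto_norm_zero_iff)
  moreover have "\<forall>\<^sub>F \<tau> in at t within S. norm (Q \<tau> - L) = norm ((J \<tau> - J t) - (\<tau> - t) *\<^sub>R L) / norm (\<tau> - t)"
    unfolding eventually_at_filter
  proof (intro always_eventually allI impI)
    fix \<tau> assume "\<tau> \<noteq> t"
    then have "Q \<tau> - L = (1 / (\<tau> - t)) *\<^sub>R ((J \<tau> - J t) - (\<tau> - t) *\<^sub>R L)"
      by (simp add: Q_def scaleR_diff_right)
    then show "norm (Q \<tau> - L) = norm ((J \<tau> - J t) - (\<tau> - t) *\<^sub>R L) / norm (\<tau> - t)"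
      by (simp add: divide_inverse mult.commute)
  qed
  ultimately have "((\<lambda>\<tau>. norm ((J \<tau> - J t) - (\<tau> - t) *\<^sub>R L) / norm (\<tau> - t)) \<longlongrightarrow> 0) (at t within S)"
    by (rule Lim_transform_eventually)
  then show ?thesis
    unfolding has_vector_derivative_def has_derivative_iff_norm J_def L_def
    by (simp add: bounded_linear_scaleR_left)
qed

text \<open>
  Integrating \<open>x\<close> by parts against the antiderivative \<open>K\<close> of the kernel replaces the cut-off of
  \<open>k (s - \<tau>)\<close> at \<open>s = \<tau>\<close> by \<open>K (max 0 (s - \<tau>))\<close>, which is Lipschitz in \<open>\<tau>\<close> and differentiable
  off \<open>s = \<tau>\<close>.
\<close>

lemma differentiable_kernel_integral:
  fixes x g :: "real \<Rightarrow> complex" and k :: "real \<Rightarrow> real"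
  assumes k: "continuous_on UNIV k"
    and x: "continuous_on {a..b} x" and g: "set_integrable lborel {a..b} g"
    and xg: "\<And>t. t \<in> {a..b} \<Longrightarrow> x t = x b - (LBINT s:{t..b}. g s)"
    and t: "t \<in> {a..b}"
  shows "(\<lambda>\<tau>. LBINT s:{\<tau>..b}. k (s - \<tau>) *\<^sub>R x s) differentiable (at t within {a..b})"
proof -
  define K where "K v = integral {0..v} k" for v
  have K0: "K 0 = 0" by (simp add: K_def)
  \<comment> \<open>For negative \<open>v\<close> the interval of integration is empty and
    \<open>K\<close> is 0, so at 0 only the one-sided derivative is claimed.\<close>
  have derK: "(K has_real_derivative k v) (at v within {0..c})" if "v \<in> {0..c}" for v c
    unfolding K_def using that by (intro integral_has_real_derivative continuous_on_subset[OF k]) auto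
  have derK_pos: "(K has_real_derivative k v) (at v)" if "v > 0" for v
    using derK[of v "v + 1"] that by (simp add: at_within_Icc_at)
  have contK: "continuous_on {0..c} K" for c
    using derK by (intro DERIV_continuous_on)
  obtain M where M: "\<And>v. v \<in> {0..b-a} \<Longrightarrow> \<bar>k v\<bar> \<le> M"
    using compact_imp_bounded[OF compact_continuous_image[OF continuous_on_subset[OF k] compact_Icc]]
    by (force simp: bounded_iff)
  have lipK: "\<bar>K v - K w\<bar> \<le> M * \<bar>v - w\<bar>" if "v \<in> {0..b-a}" "w \<in> {0..b-a}" for v w
    using field_differentiable_bound[of "{0..b-a}" K k M] derK M that by (auto simp: convex_real_interval)
  define \<kappa> where "\<kappa> s \<tau> = K (max 0 (s - \<tau>))" for s \<tau>
  define G where "G s = indicator {a..b} s *\<^sub>R g s" for s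
  have G: "integrable lborel G" using g by (simp add: G_def[abs_def] set_integrable_def)
  \<comment> \<open>Integration by parts on [\<tau>,b]: the boundary term at \<tau> vanishes since
    \<open>K 0 = 0\<close>. For the same reason \<open>\<kappa> s \<tau>\<close> is 0 for
    \<open>s \<le> \<tau>\<close>, so the remaining integral extends to a domain independent of
    \<tau>.\<close>
  have eq: "(LBINT s:{\<tau>..b}. k (s - \<tau>) *\<^sub>R x s) = K (b - \<tau>) *\<^sub>R x b - (LBINT s. \<kappa> s \<tau> *\<^sub>R G s)"
    if \<tau>: "\<tau> \<in> {a..b}" for \<tau>
  proof -
    have "(LBINT s:{\<tau>..b}. complex_of_real (K (s - \<tau>)) * g s) =
        of_real (K (b - \<tau>)) * x b - of_real (K (\<tau> - \<tau>)) * x \<tau> - (LBINT s:{\<tau>..b}. of_real (k (s - \<tau>)) * x s)"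
    proof (rule set_integral_by_parts)
      show "set_integrable lborel {\<tau>..b} g" "continuous_on {\<tau>..b} x"
        using \<tau> by (auto intro: set_integrable_subset[OF g] continuous_on_subset[OF x])
      show "x s = x b - (LBINT s:{s..b}. g s)" if "s \<in> {\<tau>..b}" for s
        using that \<tau> by (intro xg) auto
      show "((\<lambda>s. complex_of_real (K (s - \<tau>))) has_vector_derivative of_real (k (s - \<tau>))) (at s within {\<tau>..b})"
        if "s \<in> {\<tau>..b}" for s
      proof -
        have "((\<lambda>s. K (s - \<tau>)) has_real_derivative k (s - \<tau>) * 1) (at s within {\<tau>..b})"
        proof (rule DERIV_image_chain[of K _ "\<lambda>s. s - \<tau>" s "{\<tau>..b}" 1, unfolded comp_def])
          show "(K has_real_derivative k (s - \<tau>)) (at (s - \<tau>) within (\<lambda>s. s - \<tau>) ` {\<tau>..b})"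
            using derK[of "s - \<tau>" "b - \<tau>"] that by (auto elim!: DERIV_subset)
        qed (auto intro!: derivative_eq_intros)
        then show ?thesis
          by (simp add: has_vector_derivative_of_real has_real_derivative_iff_has_vector_derivative)
      qed
      show "continuous_on {\<tau>..b} (\<lambda>s. complex_of_real (k (s - \<tau>)))"
        by (intro continuous_intros continuous_on_compose2[OF k]) auto
    qed (use \<tau> in auto)
    moreover have "(LBINT s:{\<tau>..b}. complex_of_real (K (s - \<tau>)) * g s) = (LBINT s. \<kappa> s \<tau> *\<^sub>R G s)"
      unfolding set_lebesgue_integral_def
      using \<tau> by (intro Bochner_Integration.integral_cong refl)
        (auto simp: \<kappa>_def G_def K0 indicator_def scaleR_conv_of_real max_def)
    ultimately show ?thesis by (simp add: K0 scaleR_conv_of_real algebra_simps)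
  qed
  have "((\<lambda>\<tau>. LBINT s. \<kappa> s \<tau> *\<^sub>R G s) has_vector_derivative
      (LBINT s. (if s > t then - k (s - t) else 0) *\<^sub>R G s)) (at t within {a..b})"
  proof (rule has_vector_derivative_integral_lipschitz[where M = M])
    show "integrable lborel (\<lambda>s. \<kappa> s \<tau> *\<^sub>R G s)" if "\<tau> \<in> {a..b}" for \<tau>
    proof -
      have "set_integrable lborel {a..b} (\<lambda>s. of_real (\<kappa> s \<tau>) * g s)"
        unfolding \<kappa>_def using that
        by (intro set_integrable_mult_continuous g continuous_intros continuous_on_compose2[OF contK[of "b - a"]]) auto
      then show ?thesis
        by (simp add: set_integrable_def G_def scaleR_conv_of_real mult_ac)
    qed
    show "\<bar>\<kappa> s \<tau> - \<kappa> s t\<bar> \<le> M * \<bar>\<tau> - t\<bar>" if "\<tau> \<in> {a..b}" "G s \<noteq> 0" for s \<tau>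
    proof -
      have s: "s \<in> {a..b}" using that by (auto simp: G_def indicator_def split: if_splits)
      have "0 \<le> M" using M[of 0] t by (auto intro: order_trans[OF abs_ge_zero])
      moreover have "\<bar>\<kappa> s \<tau> - \<kappa> s t\<bar> \<le> M * \<bar>max 0 (s - \<tau>) - max 0 (s - t)\<bar>"
        unfolding \<kappa>_def using s t that by (intro lipK) auto
      moreover have "\<bar>max 0 (s - \<tau>) - max 0 (s - t)\<bar> \<le> \<bar>\<tau> - t\<bar>" by linarith
      ultimately show ?thesis by (meson mult_left_mono order_trans)
    qed
    \<comment> \<open>Near \<open>t\<close> the function \<open>\<kappa> s\<close> is
      \<open>K (s - \<tau>)\<close> if \<open>s > t\<close> and 0 if \<open>s < t\<close>. At
      \<open>s = t\<close> the one-sided slopes \<open>- k 0\<close> and 0 may disagree, which a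
      null set absorbs.\<close>
    have der: "((\<kappa> s) has_real_derivative (if s > t then - k (s - t) else 0)) (at t within {a..b})" if "s \<noteq> t" for s
    proof (cases "s > t")
      case True
      have "((\<lambda>\<tau>. K (s - \<tau>)) has_real_derivative - k (s - t)) (at t within {a..b})"
      proof -
        have "((\<lambda>\<tau>. s - \<tau>) has_real_derivative -1) (at t within {a..b})"
          by (auto intro!: derivative_eq_intros)
        then show ?thesis
          using True derK_pos[of "s - t"] DERIV_chain2[of K "k (s - t)" "\<lambda>\<tau>. s - \<tau>" t "-1" "{a..b}"]
          by simp
      qed
      then have "((\<kappa> s) has_real_derivative - k (s - t)) (at t within {a..b})"
      proof (rule has_field_derivative_transform_within)
        show "0 < s - t" using True by simp
        show "K (s - \<tau>) = \<kappa> s \<tau>" if "\<tau> \<in> {a..b}" "dist \<tau> t < s - t" for \<tau>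
          using that by (auto simp: \<kappa>_def dist_real_def max_def)
      qed (use t in auto)
      then show ?thesis using True by simp
    next
      case False
      have "((\<lambda>\<tau>. 0) has_real_derivative 0) (at t within {a..b})" by simp
      then have "((\<kappa> s) has_real_derivative 0) (at t within {a..b})"
      proof (rule has_field_derivative_transform_within)
        show "0 < t - s" using False that by simp
        show "0 = \<kappa> s \<tau>" if "\<tau> \<in> {a..b}" "dist \<tau> t < t - s" for \<tau>
          using that by (auto simp: \<kappa>_def dist_real_def max_def K0)
      qed (use t in auto)
      then show ?thesis using False by simp
    qed
    show "AE s in lborel. G s \<noteq> 0 \<longrightarrow> ((\<kappa> s) has_real_derivative (if s > t then - k (s - t) else 0)) (at t within {a..b})"
      using AE_lborel_singleton[of t] by eventually_elim (use der in blast)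
    have [measurable]: "k \<in> borel_measurable borel" using k by (rule borel_measurable_continuous_onI)
    show "(\<lambda>s. if s > t then - k (s - t) else 0) \<in> borel_measurable borel" by measurable
  qed (use t G in auto)
  moreover have "((\<lambda>\<tau>. K (b - \<tau>) *\<^sub>R x b) has_vector_derivative - k (b - t) *\<^sub>R x b) (at t within {a..b})"
  proof -
    have "((\<lambda>\<tau>. K (b - \<tau>)) has_real_derivative k (b - t) * (- 1)) (at t within {a..b})"
    proof (rule DERIV_image_chain[of K _ "\<lambda>\<tau>. b - \<tau>" t "{a..b}" "-1", unfolded comp_def])
      show "(K has_real_derivative k (b - t)) (at (b - t) within (\<lambda>\<tau>. b - \<tau>) ` {a..b})"
        using derK[of "b - t" "b - a"] t by (auto elim!: DERIV_subset)
    qed (auto intro!: derivative_eq_intros)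
    then show ?thesis
      by (auto simp: has_real_derivative_iff_has_vector_derivative intro!: derivative_eq_intros)
  qed
  ultimately have "((\<lambda>\<tau>. K (b - \<tau>) *\<^sub>R x b - (LBINT s. \<kappa> s \<tau> *\<^sub>R G s)) has_vector_derivative
     - k (b - t) *\<^sub>R x b - (LBINT s. (if s > t then - k (s - t) else 0) *\<^sub>R G s)) (at t within {a..b})"
    by (rule has_vector_derivative_diff[rotated])
  then have "((\<lambda>\<tau>. LBINT s:{\<tau>..b}. k (s - \<tau>) *\<^sub>R x s) has_vector_derivative
     - k (b - t) *\<^sub>R x b - (LBINT s. (if s > t then - k (s - t) else 0) *\<^sub>R G s)) (at t within {a..b})"
    by (rule has_vector_derivative_transform[rotated 2]) (use t eq in auto)
  then show ?thesis by (rule differentiableI_vector)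
qed

section \<open>Orthogonality\<close>

text \<open>The same nonzero real vector annihilates both pairs, so their 2 by 2 determinant
  vanishes.\<close>

lemma cross_eq_if_linear_relation:
  fixes c d :: real and u v u' v' :: complex
  assumes "c *\<^sub>R u + d *\<^sub>R v = 0" "c *\<^sub>R u' + d *\<^sub>R v' = 0" "c\<^sup>2 + d\<^sup>2 \<noteq> 0"
  shows "u * v' = u' * v"
proof (cases "c = 0")
  case True
  with assms have "v = 0" "v' = 0" by auto
  then show ?thesis by simp
next
  case False
  have "complex_of_real c * (u * v' - u' * v) = (c *\<^sub>R u + d *\<^sub>R v) * v' - (c *\<^sub>R u' + d *\<^sub>R v') * v"
    by (simp add: scaleR_conv_of_real algebra_simps)
  with assms False show ?thesis by simp
qed

text \<open>Membership in \<open>H1_on\<close> provides a witness, so the choice in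
  \<open>weak_deriv\<close> is a genuine weak derivative.\<close>

lemma H1_on_weak_deriv:
  assumes "H1_on a b f"
  shows "set_integrable lborel {a..b} (weak_deriv a b f)"
    and "t \<in> {a..b} \<Longrightarrow> f t = f b - (LBINT s:{t..b}. weak_deriv a b f s)"
proof -
  have "has_weak_deriv a b f (weak_deriv a b f)"
    using assms someI_ex[of "has_weak_deriv a b f"] by (simp add: H1_on_def weak_deriv_def)
  then show "set_integrable lborel {a..b} (weak_deriv a b f)"
    and "t \<in> {a..b} \<Longrightarrow> f t = f b - (LBINT s:{t..b}. weak_deriv a b f s)"
    using assms by (auto simp: H1_on_def has_weak_deriv_def L2_on_imp_set_integrable
        intro: has_weak_deriv_imp_FTC)
qed

lemma ml_integral_right_differentiable:
  assumes "\<alpha> > 0" and x: "H1_on a b x" and t: "t \<in> {a..b}"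
  shows "ml_integral_right \<alpha> b x differentiable (at t within {a..b})"
proof -
  \<comment> \<open>The kernel is known to be continuous only on nonnegative arguments;
    \<open>max 0\<close> extends it to the line, and only \<open>s - \<tau> \<ge> 0\<close> occurs
    in the integral.\<close>
  have "continuous_on UNIV (\<lambda>u. ml_kernel \<alpha> (max 0 u))"
    using assms by (intro continuous_on_compose2[OF continuous_on_ml_kernel] continuous_intros) auto
  then have "(\<lambda>\<tau>. LBINT s:{\<tau>..b}. ml_kernel \<alpha> (max 0 (s - \<tau>)) *\<^sub>R x s) differentiable (at t within {a..b})"
    using x t by (rule_tac differentiable_kernel_integral[OF _ _ H1_on_weak_deriv]) (auto simp: H1_on_def)
  moreover have "(LBINT s:{\<tau>..b}. ml_kernel \<alpha> (max 0 (s - \<tau>)) *\<^sub>R x s) = ml_integral_right \<alpha> b x \<tau>" for \<tau>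
    unfolding ml_integral_right_def by (intro set_lebesgue_integral_cong) auto
  ultimately show ?thesis by simp
qed

text \<open>Fubini moves the kernel from the derivative of \<open>y\<close> onto \<open>x\<close>;
  integration by parts then moves the derivative onto the kernel integral of \<open>x\<close>.
  Continuity of the ABR derivative makes that integral continuously differentiable.\<close>

lemma abc_left_abr_right_by_parts:
  assumes ab: "a < b" and "\<alpha> > 0" and c: "B \<alpha> / (1 - \<alpha>) \<noteq> 0"
    and x: "H1_on a b x" and y: "H1_on a b y"
    and w: "continuous_on {a..b} (abr_right B \<alpha> a b x)"
  shows "(LBINT t:{a..b}. x t * abc_left B \<alpha> a b y t) =
    (B \<alpha> / (1 - \<alpha>)) *\<^sub>R (ml_integral_right \<alpha> b x b * y b - ml_integral_right \<alpha> b x a * y a) +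
    (LBINT t:{a..b}. abr_right B \<alpha> a b x t * y t)"
proof -
  define c where "c = B \<alpha> / (1 - \<alpha>)"
  define F where "F = ml_integral_right \<alpha> b x"
  define F' where "F' t = vector_derivative F (at t within {a..b})" for t
  have abr: "abr_right B \<alpha> a b x t = - c *\<^sub>R F' t" for t
    by (simp add: abr_right_def F'_def F_def c_def ml_integral_right_def[abs_def])
  have c0: "c \<noteq> 0" using c by (simp add: c_def)
  have "F' = (\<lambda>t. (- 1 / c) *\<^sub>R abr_right B \<alpha> a b x t)"
    using c0 by (simp add: abr fun_eq_iff)
  then have F': "continuous_on {a..b} F'"
    by (simp only: continuous_on_scaleR continuous_on_const w)
  have int_x: "set_integrable lborel {a..b} x"
    using x by (intro borel_integrable_atLeastAtMost') (simp add: H1_on_def)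
  have kernel: "continuous_on {0..b - a} (ml_kernel \<alpha>)"
    using continuous_on_ml_kernel[OF \<open>\<alpha> > 0\<close>] by (rule continuous_on_subset) auto
  have "(LBINT t:{a..b}. x t * abc_left B \<alpha> a b y t) =
      c *\<^sub>R (LBINT t:{a..b}. x t * (LBINT s:{a..t}. ml_kernel \<alpha> (t - s) *\<^sub>R weak_deriv a b y s))"
    by (simp add: abc_left_def c_def)
  also have "(LBINT t:{a..b}. x t * (LBINT s:{a..t}. ml_kernel \<alpha> (t - s) *\<^sub>R weak_deriv a b y s)) =
      (LBINT s:{a..b}. weak_deriv a b y s * F s)"
    unfolding F_def ml_integral_right_def
    by (rule Fubini_triangle[OF kernel _ int_x H1_on_weak_deriv(1)[OF y]]) (use ab in simp)
  also have "\<dots> = (LBINT s:{a..b}. F s * weak_deriv a b y s)"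
    by (simp add: mult.commute)
  also have "\<dots> = F b * y b - F a * y a - (LBINT s:{a..b}. F' s * y s)"
  proof (rule set_integral_by_parts)
    show "continuous_on {a..b} y" using y by (simp add: H1_on_def)
    show "(F has_vector_derivative F' t) (at t within {a..b})" if "t \<in> {a..b}" for t
      unfolding F'_def F_def using ml_integral_right_differentiable[OF \<open>\<alpha> > 0\<close> x that]
      by (simp add: vector_derivative_works)
  qed (rule less_imp_le[OF ab] F' H1_on_weak_deriv[OF y] | assumption)+
  \<comment> \<open>The minus sign from integration by parts is the one in \<open>abr_right\<close>,
    so \<open>- c *\<^sub>R F' s\<close> is the ABR derivative of \<open>x\<close>.\<close>
  also have "c *\<^sub>R \<dots> = c *\<^sub>R (F b * y b - F a * y a) + (LBINT s:{a..b}. (- c *\<^sub>R F' s) * y s)"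
    unfolding mult_scaleR_left set_integral_scaleR_right by (simp add: scaleR_diff_right)
  finally show ?thesis by (simp only: c_def F_def abr)
qed

theorem theorem12:
  fixes a b \<alpha> :: real and B :: "real \<Rightarrow> real" and p q r :: "real \<Rightarrow> real"
    and c\<^sub>1 c\<^sub>2 d\<^sub>1 d\<^sub>2 :: real and lam\<^sub>1 lam\<^sub>2 :: complex and x\<^sub>1 x\<^sub>2 :: "real \<Rightarrow> complex"
  assumes "a < b" and "0 < \<alpha>" and "\<alpha> < 1" and "B \<alpha> > 0"
    and "continuous_on {a..b} p" and "continuous_on {a..b} q" and "continuous_on {a..b} r"
    and "\<And>t. t \<in> {a..b} \<Longrightarrow> p t \<noteq> 0" and "\<And>t. t \<in> {a..b} \<Longrightarrow> r t > 0"
    and "c\<^sub>1\<^sup>2 + c\<^sub>2\<^sup>2 \<noteq> 0" and "d\<^sub>1\<^sup>2 + d\<^sub>2\<^sup>2 \<noteq> 0"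
    and "lam\<^sub>1 \<noteq> lam\<^sub>2"
    and "fsl_eigenvalue B \<alpha> a b p q r c\<^sub>1 c\<^sub>2 d\<^sub>1 d\<^sub>2 lam\<^sub>1"
    and "fsl_eigenvalue B \<alpha> a b p q r c\<^sub>1 c\<^sub>2 d\<^sub>1 d\<^sub>2 lam\<^sub>2"
    and "fsl_eigenfunction B \<alpha> a b p q r c\<^sub>1 c\<^sub>2 d\<^sub>1 d\<^sub>2 lam\<^sub>1 x\<^sub>1"
    and "fsl_eigenfunction B \<alpha> a b p q r c\<^sub>1 c\<^sub>2 d\<^sub>1 d\<^sub>2 lam\<^sub>2 x\<^sub>2"
  shows "(LBINT t:{a..b}. r t *\<^sub>R (x\<^sub>1 t * x\<^sub>2 t)) = 0"
proof -
  let ?F = "ml_integral_right \<alpha> b" and ?D = "abr_right B \<alpha> a b"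
  let ?c = "B \<alpha> / (1 - \<alpha>)" and ?pD = "\<lambda>x t. p t *\<^sub>R abr_right B \<alpha> a b x t"
  define sol where "sol lam x \<longleftrightarrow> fsl_solution B \<alpha> a b p q r c\<^sub>1 c\<^sub>2 d\<^sub>1 d\<^sub>2 lam x" for lam x
  have sol\<^sub>1: "sol lam\<^sub>1 x\<^sub>1" and sol\<^sub>2: "sol lam\<^sub>2 x\<^sub>2"
    using assms by (auto simp: sol_def fsl_eigenfunction_def)
  have cont: "continuous_on {a..b} x" "continuous_on {a..b} (?D x)" if "sol lam x" for lam x
  proof -
    show "continuous_on {a..b} x" using that by (simp add: sol_def fsl_solution_def H1_on_def)
    have "continuous_on {a..b} (?pD x)"
      using that by (simp add: sol_def fsl_solution_def H1_on_def)
    then have "continuous_on {a..b} (\<lambda>t. (1 / p t) *\<^sub>R ?pD x t)"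
      using assms(8) by (intro continuous_on_scaleR[OF continuous_on_divide[OF continuous_on_const assms(5)]]) auto
    then show "continuous_on {a..b} (?D x)"
      by (rule continuous_on_eq) (use assms(8) in auto)
  qed
  \<comment> \<open>The equation for \<open>x\<close> is tested against \<open>z\<close>. On the
    right the integral is symmetric in \<open>x\<close> and \<open>z\<close>, so only the boundary
    terms remain to be compared.\<close>
  have equation: "lam * (LBINT t:{a..b}. r t *\<^sub>R (z t * x t)) - (LBINT t:{a..b}. q t *\<^sub>R (z t * x t)) =
      ?c *\<^sub>R (?F z b * ?pD x b - ?F z a * ?pD x a) + (LBINT t:{a..b}. p t *\<^sub>R (?D z t * ?D x t))"
    if x: "sol lam x" and z: "sol lam' z" for lam lam' x z
  proof -
    \<comment> \<open>Linearity of the integral is applied to these two continuous terms; the ABC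
      term enters only as their difference.\<close>
    have int: "set_integrable lborel {a..b} (\<lambda>t. q t *\<^sub>R (z t * x t))"
      "set_integrable lborel {a..b} (\<lambda>t. lam * (r t *\<^sub>R (z t * x t)))"
      by (intro borel_integrable_atLeastAtMost' continuous_on_mult continuous_on_scaleR
          continuous_on_const assms(6,7) cont(1)[OF x] cont(1)[OF z])+
    have eq: "lam * (r t *\<^sub>R (z t * x t)) - q t *\<^sub>R (z t * x t) = z t * abc_left B \<alpha> a b (?pD x) t"
      if "t \<in> {a<..<b}" for t
    proof -
      have "abc_left B \<alpha> a b (?pD x) t + q t *\<^sub>R x t = lam * (r t *\<^sub>R x t)"
        using x that unfolding sol_def fsl_solution_def by blast
      then have "abc_left B \<alpha> a b (?pD x) t = lam * (r t *\<^sub>R x t) - q t *\<^sub>R x t"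
        by (simp only: eq_diff_eq)
      then show ?thesis by (simp add: right_diff_distrib mult.left_commute)
    qed
    have "lam * (LBINT t:{a..b}. r t *\<^sub>R (z t * x t)) - (LBINT t:{a..b}. q t *\<^sub>R (z t * x t)) =
        (LBINT t:{a..b}. lam * (r t *\<^sub>R (z t * x t)) - q t *\<^sub>R (z t * x t))"
      by (simp only: set_integral_diff(2)[OF int(2,1)] set_integral_mult_right)
    \<comment> \<open>The differential equation holds on the open interval only, so the null
      endpoints are dropped before it is inserted.\<close>
    also have "\<dots> = (LBINT t:{a<..<b}. z t * abc_left B \<alpha> a b (?pD x) t)"
      unfolding set_integral_Icc_eq_Ioo
      by (rule set_lebesgue_integral_cong) (use eq in auto)
    also have "\<dots> = (LBINT t:{a..b}. z t * abc_left B \<alpha> a b (?pD x) t)"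
      by (rule set_integral_Icc_eq_Ioo[symmetric])
    also have "\<dots> = ?c *\<^sub>R (?F z b * ?pD x b - ?F z a * ?pD x a) + (LBINT t:{a..b}. ?D z t * ?pD x t)"
    proof (rule abc_left_abr_right_by_parts)
      show "H1_on a b z" using z unfolding sol_def fsl_solution_def by blast
      show "H1_on a b (?pD x)" using x unfolding sol_def fsl_solution_def by blast
      show "?c \<noteq> 0" using assms(3,4) by simp
    qed (rule assms cont(2)[OF z])+
    finally show ?thesis by (simp only: mult_scaleR_right)
  qed
  have "?F x\<^sub>2 a * ?D x\<^sub>1 a = ?F x\<^sub>1 a * ?D x\<^sub>2 a" "?F x\<^sub>2 b * ?D x\<^sub>1 b = ?F x\<^sub>1 b * ?D x\<^sub>2 b"
    using sol\<^sub>1 sol\<^sub>2 assms(10,11) unfolding sol_def fsl_solution_def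
    by (blast intro: cross_eq_if_linear_relation)+
  then have boundary: "?F x\<^sub>2 a * ?pD x\<^sub>1 a = ?F x\<^sub>1 a * ?pD x\<^sub>2 a" "?F x\<^sub>2 b * ?pD x\<^sub>1 b = ?F x\<^sub>1 b * ?pD x\<^sub>2 b"
    by (simp_all only: mult_scaleR_right)
  have commute: "u t *\<^sub>R (v t * w t) = u t *\<^sub>R (w t * v t)"
    for u :: "real \<Rightarrow> real" and v w :: "real \<Rightarrow> complex" and t
    by (simp only: mult.commute)
  \<comment> \<open>Both sides expand by \<open>equation\<close> with the roles exchanged;
    \<open>boundary\<close> matches the boundary terms and commutativity the integrals. No
    conjugation occurs, so complex eigenvalues cause no asymmetry.\<close>
  have "lam\<^sub>1 * (LBINT t:{a..b}. r t *\<^sub>R (x\<^sub>2 t * x\<^sub>1 t)) - (LBINT t:{a..b}. q t *\<^sub>R (x\<^sub>2 t * x\<^sub>1 t)) =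
      lam\<^sub>2 * (LBINT t:{a..b}. r t *\<^sub>R (x\<^sub>1 t * x\<^sub>2 t)) - (LBINT t:{a..b}. q t *\<^sub>R (x\<^sub>1 t * x\<^sub>2 t))"
    unfolding equation[OF sol\<^sub>1 sol\<^sub>2] equation[OF sol\<^sub>2 sol\<^sub>1] boundary
    by (subst commute) (rule refl)
  moreover have "(LBINT t:{a..b}. u t *\<^sub>R (x\<^sub>2 t * x\<^sub>1 t)) = (LBINT t:{a..b}. u t *\<^sub>R (x\<^sub>1 t * x\<^sub>2 t))" for u
    by (subst commute) (rule refl)
  ultimately have "(lam\<^sub>1 - lam\<^sub>2) * (LBINT t:{a..b}. r t *\<^sub>R (x\<^sub>1 t * x\<^sub>2 t)) = 0"
    by (simp only: left_diff_distrib) simp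
  with \<open>lam\<^sub>1 \<noteq> lam\<^sub>2\<close> show ?thesis by simp
qed

end
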